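(* Let $\mathscr{K}$ be an essentially small monoidal-triangulated category. The lattice $T_s(\mathscr{K})$ of semiprime thick $\otimes$-ideals of $\mathscr{K}$ is a spatial frame.
   Context: A monoidal-triangulated category is a triangulated category $\mathscr{K}$ with a monoidal structure $(\otimes,\mathbb{1})$, not assumed symmetric or braided, such that $\otimes$ is exact in each variable. A thick subcategory is a full triangulated subcategory closed under direct summands; a thick $\otimes$-ideal is a thick subcategory $\mathscr{I}$ with $x\otimes y,\ y\otimes x\in\mathscr{I}$ for all $x\in\mathscr{I}$, $y\in\mathscr{K}$. A proper thick $\otimes$-ideal $\mathscr{P}$ is prime if for all thick $\otimes$-ideals $\mathscr{I},\mathscr{J}$, $\mathscr{I}\otimes\mathscr{J}\subseteq\mathscr{P}$ implies $\mathscr{I}\subseteq\mathscr{P}$ or $\mathscr{J}\subseteq\mathscr{P}$. A thick $\otimes$-ideal is semiprime if it is an intersection of primes ($\mathscr{K}$ being the empty intersection). $T_s(\mathscr{K})$ is ordered by inclusion. A frame is a complete lattice in which arbitrary joins distribute over finite meets. A frame $\mathscr{F}$ is spatial if whenever $x\not\le y$ in $\mathscr{F}$ there is a frame morphism $p\colon\mathscr{F}\to\{0<1\}$ (preserving arbitrary joins and finite meets) with $p(x)=1$ and $p(y)=0$. *)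

theory Defs
  imports "HOL-Algebra.Group"
begin

section \<open>Categories, functors and natural isomorphisms\<close>

text \<open>
  Hom-sets are pairwise disjoint: every arrow carries its domain and codomain.
  \<open>Cmp C g f\<close> is "g after f"; it is constrained only for composable arrows.
\<close>

record ('o, 'm) category_data =
  Obj :: "'o set"
  Arr :: "'m set"
  Dom :: "'m \<Rightarrow> 'o"
  Cod :: "'m \<Rightarrow> 'o"
  Idt :: "'o \<Rightarrow> 'm"
  Cmp :: "'m \<Rightarrow> 'm \<Rightarrow> 'm"  (infixl \<open>\<cdot>\<index>\<close> 70)

definition Hom :: "('o, 'm, 'z) category_data_scheme \<Rightarrow> 'o \<Rightarrow> 'o \<Rightarrow> 'm set" where
  "Hom C X Y = {f \<in> Arr C. Dom C f = X \<and> Cod C f = Y}"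

locale category =
  fixes C :: "('o, 'm, 'z) category_data_scheme" (structure)
  assumes Dom_closed: "f \<in> Arr C \<Longrightarrow> Dom C f \<in> Obj C"
    and Cod_closed: "f \<in> Arr C \<Longrightarrow> Cod C f \<in> Obj C"
    and Idt_closed: "X \<in> Obj C \<Longrightarrow> Idt C X \<in> Hom C X X"
    and Cmp_closed: "\<lbrakk>f \<in> Hom C X Y; g \<in> Hom C Y Z\<rbrakk> \<Longrightarrow> g \<cdot> f \<in> Hom C X Z"
    and Cmp_Idt_right: "f \<in> Hom C X Y \<Longrightarrow> f \<cdot> Idt C X = f"
    and Cmp_Idt_left: "f \<in> Hom C X Y \<Longrightarrow> Idt C Y \<cdot> f = f"
    and Cmp_assoc: "\<lbrakk>f \<in> Hom C W X; g \<in> Hom C X Y; h \<in> Hom C Y Z\<rbrakk>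
      \<Longrightarrow> (h \<cdot> g) \<cdot> f = h \<cdot> (g \<cdot> f)"

definition iso_arrow :: "('o, 'm, 'z) category_data_scheme \<Rightarrow> 'm \<Rightarrow> bool" where
  "iso_arrow C f \<longleftrightarrow> f \<in> Arr C \<and>
     (\<exists>g \<in> Hom C (Cod C f) (Dom C f).
        g \<cdot>\<^bsub>C\<^esub> f = Idt C (Dom C f) \<and> f \<cdot>\<^bsub>C\<^esub> g = Idt C (Cod C f))"

definition isomorphic :: "('o, 'm, 'z) category_data_scheme \<Rightarrow> 'o \<Rightarrow> 'o \<Rightarrow> bool" where
  "isomorphic C X Y \<longleftrightarrow> (\<exists>f \<in> Hom C X Y. iso_arrow C f)"

text \<open>
  Smallness is relative to a universe, given by a type \<open>'u\<close>: a collection is small if it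
  injects into \<open>'u\<close>. A category is essentially small if the full subcategory on some set
  \<open>S\<close> of objects meeting every isomorphism class has a small collection of arrows (hence also
  of objects, via identities). Any category in the present sense is essentially small for a
  sufficiently large \<open>'u\<close>.
\<close>

definition essentially_small :: "'u itself \<Rightarrow> ('o, 'm, 'z) category_data_scheme \<Rightarrow> bool" where
  "essentially_small U C \<longleftrightarrow>
     (\<exists>S \<subseteq> Obj C. (\<forall>X \<in> Obj C. \<exists>Y \<in> S. isomorphic C X Y) \<and>
        (\<exists>e :: 'm \<Rightarrow> 'u. inj_on e {f \<in> Arr C. Dom C f \<in> S \<and> Cod C f \<in> S}))"

definition is_functor ::
  "('o, 'm, 'z) category_data_scheme \<Rightarrow> ('p, 'n, 'y) category_data_scheme \<Rightarrow>
   ('o \<Rightarrow> 'p) \<Rightarrow> ('m \<Rightarrow> 'n) \<Rightarrow> bool" where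
  "is_functor C D Fo Fa \<longleftrightarrow>
     (\<forall>X \<in> Obj C. Fo X \<in> Obj D) \<and>
     (\<forall>X Y. \<forall>f \<in> Hom C X Y. Fa f \<in> Hom D (Fo X) (Fo Y)) \<and>
     (\<forall>X \<in> Obj C. Fa (Idt C X) = Idt D (Fo X)) \<and>
     (\<forall>X Y Z. \<forall>f \<in> Hom C X Y. \<forall>g \<in> Hom C Y Z. Fa (g \<cdot>\<^bsub>C\<^esub> f) = Fa g \<cdot>\<^bsub>D\<^esub> Fa f)"

definition equivalence_functor ::
  "('o, 'm, 'z) category_data_scheme \<Rightarrow> ('p, 'n, 'y) category_data_scheme \<Rightarrow>
   ('o \<Rightarrow> 'p) \<Rightarrow> ('m \<Rightarrow> 'n) \<Rightarrow> bool" where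
  "equivalence_functor C D Fo Fa \<longleftrightarrow> is_functor C D Fo Fa \<and>
     (\<forall>X \<in> Obj C. \<forall>Y \<in> Obj C. bij_betw Fa (Hom C X Y) (Hom D (Fo X) (Fo Y))) \<and>
     (\<forall>Y \<in> Obj D. \<exists>X \<in> Obj C. isomorphic D (Fo X) Y)"

definition natural_iso ::
  "('o, 'm, 'z) category_data_scheme \<Rightarrow> ('p, 'n, 'y) category_data_scheme \<Rightarrow>
   ('o \<Rightarrow> 'p) \<Rightarrow> ('m \<Rightarrow> 'n) \<Rightarrow> ('o \<Rightarrow> 'p) \<Rightarrow> ('m \<Rightarrow> 'n) \<Rightarrow> ('o \<Rightarrow> 'n) \<Rightarrow> bool" where
  "natural_iso C D Fo Fa Go Ga \<theta> \<longleftrightarrow>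
     (\<forall>X \<in> Obj C. \<theta> X \<in> Hom D (Fo X) (Go X) \<and> iso_arrow D (\<theta> X)) \<and>
     (\<forall>X Y. \<forall>f \<in> Hom C X Y. \<theta> Y \<cdot>\<^bsub>D\<^esub> Fa f = Ga f \<cdot>\<^bsub>D\<^esub> \<theta> X)"


section \<open>Additive categories\<close>

text \<open>\<open>Zer C X Y\<close> is the zero arrow from \<open>X\<close> to \<open>Y\<close>.\<close>

record ('o, 'm) additive_data = "('o, 'm) category_data" +
  Add :: "'m \<Rightarrow> 'm \<Rightarrow> 'm"
  Zer :: "'o \<Rightarrow> 'o \<Rightarrow> 'm"

definition hom_group :: "('o, 'm, 'z) additive_data_scheme \<Rightarrow> 'o \<Rightarrow> 'o \<Rightarrow> 'm monoid" where
  "hom_group C X Y = \<lparr>carrier = Hom C X Y, monoid.mult = Add C, one = Zer C X Y\<rparr>"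

definition Neg :: "('o, 'm, 'z) additive_data_scheme \<Rightarrow> 'm \<Rightarrow> 'm" where
  "Neg C f = inv\<^bsub>hom_group C (Dom C f) (Cod C f)\<^esub> f"

definition zero_object :: "('o, 'm, 'z) category_data_scheme \<Rightarrow> 'o \<Rightarrow> bool" where
  "zero_object C Z \<longleftrightarrow> Z \<in> Obj C \<and>
     (\<forall>X \<in> Obj C. (\<exists>!f. f \<in> Hom C X Z) \<and> (\<exists>!f. f \<in> Hom C Z X))"

definition is_biproduct :: "('o, 'm, 'z) additive_data_scheme \<Rightarrow> 'o \<Rightarrow> 'o \<Rightarrow> 'o \<Rightarrow> bool" where
  "is_biproduct C A B Y \<longleftrightarrow>
     (\<exists>i \<in> Hom C A Y. \<exists>j \<in> Hom C B Y. \<exists>p \<in> Hom C Y A. \<exists>q \<in> Hom C Y B.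
        p \<cdot>\<^bsub>C\<^esub> i = Idt C A \<and> q \<cdot>\<^bsub>C\<^esub> j = Idt C B \<and>
        p \<cdot>\<^bsub>C\<^esub> j = Zer C B A \<and> q \<cdot>\<^bsub>C\<^esub> i = Zer C A B \<and>
        Add C (i \<cdot>\<^bsub>C\<^esub> p) (j \<cdot>\<^bsub>C\<^esub> q) = Idt C Y)"

locale additive_category = category C
  for C :: "('o, 'm, 'z) additive_data_scheme" (structure) +
  assumes hom_comm_group: "\<lbrakk>X \<in> Obj C; Y \<in> Obj C\<rbrakk> \<Longrightarrow> comm_group (hom_group C X Y)"
    and Cmp_Add_left: "\<lbrakk>f \<in> Hom C X Y; g \<in> Hom C Y Z; g' \<in> Hom C Y Z\<rbrakk>
      \<Longrightarrow> Add C g g' \<cdot> f = Add C (g \<cdot> f) (g' \<cdot> f)"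
    and Cmp_Add_right: "\<lbrakk>f \<in> Hom C X Y; f' \<in> Hom C X Y; g \<in> Hom C Y Z\<rbrakk>
      \<Longrightarrow> g \<cdot> Add C f f' = Add C (g \<cdot> f) (g \<cdot> f')"
    and zero_object_exists: "\<exists>Z. zero_object C Z"
    and biproduct_exists: "\<lbrakk>A \<in> Obj C; B \<in> Obj C\<rbrakk> \<Longrightarrow> \<exists>Y \<in> Obj C. is_biproduct C A B Y"

definition additive_functor ::
  "('o, 'm, 'z) additive_data_scheme \<Rightarrow> ('p, 'n, 'y) additive_data_scheme \<Rightarrow>
   ('o \<Rightarrow> 'p) \<Rightarrow> ('m \<Rightarrow> 'n) \<Rightarrow> bool" where
  "additive_functor C D Fo Fa \<longleftrightarrow> is_functor C D Fo Fa \<and>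
     (\<forall>X Y. \<forall>f \<in> Hom C X Y. \<forall>g \<in> Hom C X Y. Fa (Add C f g) = Add D (Fa f) (Fa g))"


section \<open>Triangulated categories\<close>

text \<open>
  \<open>ShO\<close>, \<open>ShA\<close> are the shift functor on objects and arrows. A member \<open>(f, g, h)\<close> of \<open>Dist\<close>
  is a distinguished triangle X -f-> Y -g-> Z -h-> (shift of X).
\<close>

record ('o, 'm) triangulated_data = "('o, 'm) additive_data" +
  ShO :: "'o \<Rightarrow> 'o"
  ShA :: "'m \<Rightarrow> 'm"
  Dist :: "('m \<times> 'm \<times> 'm) set"

definition is_triangle ::
  "('o, 'm, 'z) triangulated_data_scheme \<Rightarrow> 'o \<Rightarrow> 'o \<Rightarrow> 'o \<Rightarrow> 'm \<Rightarrow> 'm \<Rightarrow> 'm \<Rightarrow> bool" where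
  "is_triangle K X Y Z f g h \<longleftrightarrow>
     f \<in> Hom K X Y \<and> g \<in> Hom K Y Z \<and> h \<in> Hom K Z (ShO K X)"

definition dist_triangle ::
  "('o, 'm, 'z) triangulated_data_scheme \<Rightarrow> 'o \<Rightarrow> 'o \<Rightarrow> 'o \<Rightarrow> 'm \<Rightarrow> 'm \<Rightarrow> 'm \<Rightarrow> bool" where
  "dist_triangle K X Y Z f g h \<longleftrightarrow> is_triangle K X Y Z f g h \<and> (f, g, h) \<in> Dist K"

definition triangle_morphism ::
  "('o, 'm, 'z) triangulated_data_scheme \<Rightarrow> 'm \<Rightarrow> 'm \<Rightarrow> 'm \<Rightarrow> 'm \<Rightarrow> 'm \<Rightarrow> 'm \<Rightarrow>
   'm \<Rightarrow> 'm \<Rightarrow> 'm \<Rightarrow> bool" where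
  "triangle_morphism K f g h f' g' h' u v w \<longleftrightarrow>
     v \<cdot>\<^bsub>K\<^esub> f = f' \<cdot>\<^bsub>K\<^esub> u \<and> w \<cdot>\<^bsub>K\<^esub> g = g' \<cdot>\<^bsub>K\<^esub> v \<and> ShA K u \<cdot>\<^bsub>K\<^esub> h = h' \<cdot>\<^bsub>K\<^esub> w"

text \<open>The shift is an additive autoequivalence, not necessarily an automorphism.\<close>

locale triangulated_category = additive_category K
  for K :: "('o, 'm, 'z) triangulated_data_scheme" (structure) +
  assumes shift_additive: "additive_functor K K (ShO K) (ShA K)"
    and shift_equivalence: "equivalence_functor K K (ShO K) (ShA K)"
    and Dist_triangle: "(f, g, h) \<in> Dist K \<Longrightarrow> \<exists>X Y Z. is_triangle K X Y Z f g h"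
    and TR1_iso: "\<lbrakk>dist_triangle K X Y Z f g h; is_triangle K X' Y' Z' f' g' h';
        u \<in> Hom K X X'; v \<in> Hom K Y Y'; w \<in> Hom K Z Z';
        iso_arrow K u; iso_arrow K v; iso_arrow K w;
        triangle_morphism K f g h f' g' h' u v w\<rbrakk>
      \<Longrightarrow> dist_triangle K X' Y' Z' f' g' h'"
    and TR1_identity: "\<lbrakk>X \<in> Obj K; zero_object K Z\<rbrakk>
      \<Longrightarrow> dist_triangle K X X Z (Idt K X) (Zer K X Z) (Zer K Z (ShO K X))"
    and TR1_cone: "f \<in> Hom K X Y \<Longrightarrow> \<exists>Z g h. dist_triangle K X Y Z f g h"
    and TR2_rotation: "is_triangle K X Y Z f g h
      \<Longrightarrow> dist_triangle K X Y Z f g h \<longleftrightarrow>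
          dist_triangle K Y Z (ShO K X) g h (Neg K (ShA K f))"
    and TR3_morphism: "\<lbrakk>dist_triangle K X Y Z f g h; dist_triangle K X' Y' Z' f' g' h';
        u \<in> Hom K X X'; v \<in> Hom K Y Y'; v \<cdot> f = f' \<cdot> u\<rbrakk>
      \<Longrightarrow> \<exists>w \<in> Hom K Z Z'. triangle_morphism K f g h f' g' h' u v w"
    and TR4_octahedron: "\<lbrakk>f \<in> Hom K X Y; g \<in> Hom K Y Z;
        dist_triangle K X Y A f i j;
        dist_triangle K X Z B (g \<cdot> f) k l;
        dist_triangle K Y Z D g p q\<rbrakk>
      \<Longrightarrow> \<exists>a \<in> Hom K A B. \<exists>b \<in> Hom K B D.
            dist_triangle K A B D a b (ShA K i \<cdot> q) \<and>
            triangle_morphism K f i j (g \<cdot> f) k l (Idt K X) g a \<and>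
            triangle_morphism K (g \<cdot> f) k l g p q f (Idt K Z) b"

definition exact_functor ::
  "('o, 'm, 'z) triangulated_data_scheme \<Rightarrow> ('p, 'n, 'y) triangulated_data_scheme \<Rightarrow>
   ('o \<Rightarrow> 'p) \<Rightarrow> ('m \<Rightarrow> 'n) \<Rightarrow> bool" where
  "exact_functor K L Fo Fa \<longleftrightarrow> additive_functor K L Fo Fa \<and>
     (\<exists>\<theta>. natural_iso K L (Fo \<circ> ShO K) (Fa \<circ> ShA K) (ShO L \<circ> Fo) (ShA L \<circ> Fa) \<theta> \<and>
        (\<forall>X Y Z f g h. dist_triangle K X Y Z f g h \<longrightarrow>
           dist_triangle L (Fo X) (Fo Y) (Fo Z) (Fa f) (Fa g) (\<theta> X \<cdot>\<^bsub>L\<^esub> Fa h)))"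


section \<open>Monoidal-triangulated categories\<close>

record ('o, 'm) mt_data = "('o, 'm) triangulated_data" +
  TenO :: "'o \<Rightarrow> 'o \<Rightarrow> 'o"
  TenA :: "'m \<Rightarrow> 'm \<Rightarrow> 'm"
  Unt :: "'o"
  Assoc :: "'o \<Rightarrow> 'o \<Rightarrow> 'o \<Rightarrow> 'm"  \<comment> \<open>from \<open>(X \<otimes> Y) \<otimes> Z\<close> to \<open>X \<otimes> (Y \<otimes> Z)\<close>\<close>
  Lun :: "'o \<Rightarrow> 'm"  \<comment> \<open>from \<open>1 \<otimes> X\<close> to \<open>X\<close>\<close>
  Run :: "'o \<Rightarrow> 'm"  \<comment> \<open>from \<open>X \<otimes> 1\<close> to \<open>X\<close>\<close>

locale monoidal_category = category K
  for K :: "('o, 'm, 'z) mt_data_scheme" (structure) +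
  assumes TenO_closed: "\<lbrakk>X \<in> Obj K; Y \<in> Obj K\<rbrakk> \<Longrightarrow> TenO K X Y \<in> Obj K"
    and TenA_closed: "\<lbrakk>f \<in> Hom K X X'; g \<in> Hom K Y Y'\<rbrakk>
      \<Longrightarrow> TenA K f g \<in> Hom K (TenO K X Y) (TenO K X' Y')"
    and TenA_Idt: "\<lbrakk>X \<in> Obj K; Y \<in> Obj K\<rbrakk>
      \<Longrightarrow> TenA K (Idt K X) (Idt K Y) = Idt K (TenO K X Y)"
    and TenA_Cmp: "\<lbrakk>f \<in> Hom K X X'; f' \<in> Hom K X' X''; g \<in> Hom K Y Y'; g' \<in> Hom K Y' Y''\<rbrakk>
      \<Longrightarrow> TenA K (f' \<cdot> f) (g' \<cdot> g) = TenA K f' g' \<cdot> TenA K f g"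
    and Unt_closed: "Unt K \<in> Obj K"
    and Assoc_closed: "\<lbrakk>X \<in> Obj K; Y \<in> Obj K; Z \<in> Obj K\<rbrakk>
      \<Longrightarrow> Assoc K X Y Z \<in> Hom K (TenO K (TenO K X Y) Z) (TenO K X (TenO K Y Z))"
    and Assoc_iso: "\<lbrakk>X \<in> Obj K; Y \<in> Obj K; Z \<in> Obj K\<rbrakk> \<Longrightarrow> iso_arrow K (Assoc K X Y Z)"
    and Assoc_natural: "\<lbrakk>f \<in> Hom K X X'; g \<in> Hom K Y Y'; h \<in> Hom K Z Z'\<rbrakk>
      \<Longrightarrow> Assoc K X' Y' Z' \<cdot> TenA K (TenA K f g) h = TenA K f (TenA K g h) \<cdot> Assoc K X Y Z"
    and Lun_natural_iso: "natural_iso K K (TenO K (Unt K)) (TenA K (Idt K (Unt K))) id id (Lun K)"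
    and Run_natural_iso: "natural_iso K K (\<lambda>X. TenO K X (Unt K)) (\<lambda>f. TenA K f (Idt K (Unt K)))
      id id (Run K)"
    and pentagon: "\<lbrakk>W \<in> Obj K; X \<in> Obj K; Y \<in> Obj K; Z \<in> Obj K\<rbrakk>
      \<Longrightarrow> Assoc K W X (TenO K Y Z) \<cdot> Assoc K (TenO K W X) Y Z =
          TenA K (Idt K W) (Assoc K X Y Z) \<cdot> Assoc K W (TenO K X Y) Z
            \<cdot> TenA K (Assoc K W X Y) (Idt K Z)"
    and triangle: "\<lbrakk>X \<in> Obj K; Y \<in> Obj K\<rbrakk>
      \<Longrightarrow> TenA K (Idt K X) (Lun K Y) \<cdot> Assoc K X (Unt K) Y = TenA K (Run K X) (Idt K Y)"

locale monoidal_triangulated_category = triangulated_category K + monoidal_category K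
  for K :: "('o, 'm, 'z) mt_data_scheme" (structure) +
  assumes exact_right: "X \<in> Obj K
      \<Longrightarrow> exact_functor K K (\<lambda>Y. TenO K X Y) (\<lambda>g. TenA K (Idt K X) g)"
    and exact_left: "Y \<in> Obj K
      \<Longrightarrow> exact_functor K K (\<lambda>X. TenO K X Y) (\<lambda>f. TenA K f (Idt K Y))"


section \<open>Thick tensor ideals\<close>

text \<open>
  Full subcategories are identified with their sets of objects. Closure under desuspension is
  the right-to-left direction of the shift condition (the shift being only an equivalence), and
  the remaining cases of "two out of three" follow by rotation.
\<close>

definition triangulated_subcategory :: "('o, 'm, 'z) triangulated_data_scheme \<Rightarrow> 'o set \<Rightarrow> bool"
  where
  "triangulated_subcategory K I \<longleftrightarrow> I \<subseteq> Obj K \<and>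
     (\<forall>Z. zero_object K Z \<longrightarrow> Z \<in> I) \<and>
     (\<forall>X \<in> I. \<forall>Y \<in> Obj K. isomorphic K X Y \<longrightarrow> Y \<in> I) \<and>
     (\<forall>X \<in> Obj K. ShO K X \<in> I \<longleftrightarrow> X \<in> I) \<and>
     (\<forall>X Y Z f g h. dist_triangle K X Y Z f g h \<longrightarrow> X \<in> I \<longrightarrow> Y \<in> I \<longrightarrow> Z \<in> I)"

definition thick_subcategory :: "('o, 'm, 'z) triangulated_data_scheme \<Rightarrow> 'o set \<Rightarrow> bool" where
  "thick_subcategory K I \<longleftrightarrow> triangulated_subcategory K I \<and>
     (\<forall>Y \<in> I. \<forall>A \<in> Obj K. \<forall>B \<in> Obj K. is_biproduct K A B Y \<longrightarrow> A \<in> I \<and> B \<in> I)"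

definition thick_ideal :: "('o, 'm, 'z) mt_data_scheme \<Rightarrow> 'o set \<Rightarrow> bool" where
  "thick_ideal K I \<longleftrightarrow> thick_subcategory K I \<and>
     (\<forall>X \<in> I. \<forall>Y \<in> Obj K. TenO K X Y \<in> I \<and> TenO K Y X \<in> I)"

definition prime_ideal :: "('o, 'm, 'z) mt_data_scheme \<Rightarrow> 'o set \<Rightarrow> bool" where
  "prime_ideal K P \<longleftrightarrow> thick_ideal K P \<and> P \<noteq> Obj K \<and>
     (\<forall>I J. thick_ideal K I \<longrightarrow> thick_ideal K J \<longrightarrow>
        {TenO K X Y | X Y. X \<in> I \<and> Y \<in> J} \<subseteq> P \<longrightarrow> I \<subseteq> P \<or> J \<subseteq> P)"

text \<open>The intersection with \<open>Obj K\<close> makes the empty intersection the whole category.\<close>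

definition semiprime_ideal :: "('o, 'm, 'z) mt_data_scheme \<Rightarrow> 'o set \<Rightarrow> bool" where
  "semiprime_ideal K I \<longleftrightarrow> thick_ideal K I \<and>
     (\<exists>S \<subseteq> {P. prime_ideal K P}. I = Obj K \<inter> \<Inter>S)"

definition semiprime_lattice :: "('o, 'm, 'z) mt_data_scheme \<Rightarrow> 'o set gorder"  (\<open>T\<^sub>s\<close>) where
  "T\<^sub>s K = \<lparr>carrier = {I. semiprime_ideal K I}, eq = (=), le = (\<subseteq>)\<rparr>"


section \<open>Spatial frames\<close>

locale frame = complete_lattice L
  for L :: "('a, 'z) gorder_scheme" (structure) +
  assumes meet_sup_distrib: "\<lbrakk>x \<in> carrier L; A \<subseteq> carrier L\<rbrakk>
    \<Longrightarrow> x \<sqinter> \<Squnion>A = \<Squnion>((\<lambda>a. x \<sqinter> a) ` A)"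

definition frame_morphism ::
  "('a, 'z) gorder_scheme \<Rightarrow> ('b, 'y) gorder_scheme \<Rightarrow> ('a \<Rightarrow> 'b) \<Rightarrow> bool" where
  "frame_morphism L M p \<longleftrightarrow> p \<in> carrier L \<rightarrow> carrier M \<and>
     (\<forall>A \<subseteq> carrier L. p (\<Squnion>\<^bsub>L\<^esub>A) = \<Squnion>\<^bsub>M\<^esub>(p ` A)) \<and>
     (\<forall>A \<subseteq> carrier L. finite A \<longrightarrow> p (\<Sqinter>\<^bsub>L\<^esub>A) = \<Sqinter>\<^bsub>M\<^esub>(p ` A))"

text \<open>The frame \<open>{0 < 1}\<close>, with \<open>0 = False\<close> and \<open>1 = True\<close>.\<close>

definition two_frame :: "bool gorder" where
  "two_frame = \<lparr>carrier = UNIV, eq = (=), le = (\<le>)\<rparr>"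

locale spatial_frame = frame L
  for L :: "('a, 'z) gorder_scheme" (structure) +
  assumes points_separate: "\<lbrakk>x \<in> carrier L; y \<in> carrier L; \<not> x \<sqsubseteq> y\<rbrakk>
    \<Longrightarrow> \<exists>p. frame_morphism L two_frame p \<and> p x = True \<and> p y = False"

end

theory Submission
  imports Defs
begin

text \<open>
  A semiprime ideal is determined by the set of primes containing it. If \<open>I\<close> and \<open>J\<close> are thick
  ideals then \<open>I \<otimes> J \<subseteq> I \<inter> J\<close>, so a prime containing \<open>I \<inter> J\<close> contains \<open>I\<close> or \<open>J\<close>. Hence meets are
  intersections, the join of a family is the intersection of all primes containing its union, and
  the semiprime ideals form the frame of sets \<open>{P. \<not> I \<subseteq> P}\<close> of a topology on the set of primes,
  whose points are the maps \<open>I \<mapsto> \<not> I \<subseteq> P\<close>.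
\<close>

section \<open>The two-element frame\<close>

lemma two_frame_simps [simp]:
  "carrier two_frame = UNIV" "(x \<sqsubseteq>\<^bsub>two_frame\<^esub> y) = (x \<longrightarrow> y)" "(.=\<^bsub>two_frame\<^esub>) = (=)"
  by (auto simp: two_frame_def)

interpretation two_frame: partial_order two_frame
  by unfold_locales auto

lemma two_frame_sup: "\<Squnion>\<^bsub>two_frame\<^esub>A = (True \<in> A)"
proof -
  have "least two_frame (True \<in> A) (Upper two_frame A)"
  proof (rule least_UpperI)
    fix y assume "y \<in> Upper two_frame A"
    then show "(True \<in> A) \<sqsubseteq>\<^bsub>two_frame\<^esub> y" by (simp add: Upper_def)
  next
    fix x assume "x \<in> A"
    then show "x \<sqsubseteq>\<^bsub>two_frame\<^esub> (True \<in> A)" by (cases x) simp_all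
  qed simp_all
  \<comment> \<open>The supremum is a least upper bound picked by choice, so uniqueness of least
    elements is what identifies it. For empty \<open>A\<close> the value is the bottom
    \<open>False\<close>.\<close>
  then show ?thesis
    unfolding sup_def by (intro some_equality two_frame.least_unique)
qed

lemma two_frame_inf: "\<Sqinter>\<^bsub>two_frame\<^esub>A = (False \<notin> A)"
proof -
  have "greatest two_frame (False \<notin> A) (Lower two_frame A)"
  proof (rule greatest_LowerI)
    fix y assume "y \<in> Lower two_frame A"
    then show "y \<sqsubseteq>\<^bsub>two_frame\<^esub> (False \<notin> A)" by (auto simp: Lower_def)
  next
    fix x assume "x \<in> A"
    then show "(False \<notin> A) \<sqsubseteq>\<^bsub>two_frame\<^esub> x" by (cases x) simp_all
  qed simp_all
  then show ?thesis
    unfolding inf_def by (intro some_equality two_frame.greatest_unique)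
qed

section \<open>Intersections of meet-prime sets\<close>

locale meet_prime_family =
  fixes U :: "'a set" and Ps :: "'a set set"
  assumes subset_top: "P \<in> Ps \<Longrightarrow> P \<subseteq> U"
    and proper: "P \<in> Ps \<Longrightarrow> P \<noteq> U"
    and meet_prime: "\<lbrakk>P \<in> Ps; S \<subseteq> Ps; T \<subseteq> Ps; U \<inter> \<Inter>S \<inter> \<Inter>T \<subseteq> P\<rbrakk>
      \<Longrightarrow> U \<inter> \<Inter>S \<subseteq> P \<or> U \<inter> \<Inter>T \<subseteq> P"
begin

definition closed_sets :: "'a set set" where
  "closed_sets = {I. \<exists>S\<subseteq>Ps. I = U \<inter> \<Inter>S}"

definition closed_lattice :: "'a set gorder" where
  "closed_lattice = \<lparr>carrier = closed_sets, eq = (=), le = (\<subseteq>)\<rparr>"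

text \<open>For \<open>X\<close> inside \<open>U\<close> this is the closure of \<open>X\<close>;
  for prime ideals it is the semiprime ideal generated by \<open>X\<close>.\<close>

definition hull :: "'a set \<Rightarrow> 'a set" where
  "hull X = U \<inter> \<Inter>{P \<in> Ps. X \<subseteq> P}"

lemma closed_lattice_simps [simp]:
  "carrier closed_lattice = closed_sets" "(x \<sqsubseteq>\<^bsub>closed_lattice\<^esub> y) = (x \<subseteq> y)" "(.=\<^bsub>closed_lattice\<^esub>) = (=)"
  by (simp_all add: closed_lattice_def)

lemma hull_closed: "hull X \<in> closed_sets"
  by (auto simp: hull_def closed_sets_def)

text \<open>If \<open>X\<close> lies in \<open>P\<close>, then \<open>P\<close> is one of the sets
  intersected; conversely \<open>X\<close> lies in its hull because it lies in \<open>U\<close>. So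
  members of \<open>Ps\<close> cannot tell \<open>X\<close> from its hull.\<close>

lemma hull_subset_iff: "P \<in> Ps \<Longrightarrow> X \<subseteq> U \<Longrightarrow> hull X \<subseteq> P \<longleftrightarrow> X \<subseteq> P"
  by (auto simp: hull_def)

lemma closed_subset_top: "I \<in> closed_sets \<Longrightarrow> I \<subseteq> U"
  by (auto simp: closed_sets_def)

text \<open>A closed set is cut out by the members of \<open>Ps\<close> above it, so inclusion in it
  can be tested on them. Read contrapositively, this supplies separating points.\<close>

lemma closed_subsetI:
  assumes "I \<in> closed_sets" "X \<subseteq> U" "\<And>P. P \<in> Ps \<Longrightarrow> I \<subseteq> P \<Longrightarrow> X \<subseteq> P"
  shows "X \<subseteq> I"
proof -
  obtain S where S: "S \<subseteq> Ps" "I = U \<inter> \<Inter>S"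
    using assms(1) by (auto simp: closed_sets_def)
  have "X \<subseteq> P" if "P \<in> S" for P
    using assms(3)[of P] that S by blast
  then show ?thesis using S assms(2) by blast
qed

lemma Inter_closed:
  assumes "A \<subseteq> closed_sets"
  shows "U \<inter> \<Inter>A \<in> closed_sets"
proof -
  \<comment> \<open>Closedness is shown by comparing the intersection with its own hull, which
    avoids choosing a family of members of \<open>Ps\<close> for each \<open>a\<close>.\<close>
  have "hull (U \<inter> \<Inter>A) \<subseteq> a" if "a \<in> A" for a
  proof (rule closed_subsetI)
    fix P assume "P \<in> Ps" "a \<subseteq> P"
    then show "hull (U \<inter> \<Inter>A) \<subseteq> P"
      using that by (subst hull_subset_iff) auto
  qed (use assms that in \<open>auto simp: hull_def\<close>)
  then have "U \<inter> \<Inter>A = hull (U \<inter> \<Inter>A)"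
    by (auto simp: hull_def)
  then show ?thesis using hull_closed by metis
qed

lemma Int_closed: "I \<in> closed_sets \<Longrightarrow> J \<in> closed_sets \<Longrightarrow> I \<inter> J \<in> closed_sets"
  using Inter_closed[of "{I, J}"] closed_subset_top[of I] by (simp add: Int_absorb1 le_infI1)

text \<open>Meet-primeness extended from explicit intersections to closed sets; both the frame law
  and the preservation of meets by points rest on it.\<close>

lemma Int_subset_iff:
  assumes "P \<in> Ps" "I \<in> closed_sets" "J \<in> closed_sets"
  shows "I \<inter> J \<subseteq> P \<longleftrightarrow> I \<subseteq> P \<or> J \<subseteq> P"
proof
  assume le: "I \<inter> J \<subseteq> P"
  obtain S where S: "S \<subseteq> Ps" "I = U \<inter> \<Inter>S"
    using assms(2) by (auto simp: closed_sets_def)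
  obtain T where T: "T \<subseteq> Ps" "J = U \<inter> \<Inter>T"
    using assms(3) by (auto simp: closed_sets_def)
  have "U \<inter> \<Inter>S \<inter> \<Inter>T \<subseteq> P"
    using le S T by auto
  then show "I \<subseteq> P \<or> J \<subseteq> P"
    using meet_prime[OF assms(1) S(1) T(1)] S T by blast
qed auto

lemma finite_Inter_subset_iff:
  assumes "P \<in> Ps" "finite A" "A \<subseteq> closed_sets"
  shows "U \<inter> \<Inter>A \<subseteq> P \<longleftrightarrow> (\<exists>a\<in>A. a \<subseteq> P)"
  using assms(2,3)
proof (induction A)
  \<comment> \<open>The empty intersection is \<open>U\<close>, which is not inside \<open>P\<close>
    because \<open>P\<close> is proper: points send the top to \<open>True\<close>.\<close>
  case empty
  then show ?case using subset_top[of P] proper[of P] assms(1) by auto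
next
  case (insert a A)
  have "U \<inter> \<Inter>(insert a A) = a \<inter> (U \<inter> \<Inter>A)" by auto
  then show ?case
    using insert Int_subset_iff[OF assms(1), of a "U \<inter> \<Inter>A"] Inter_closed[of A] by auto
qed

sublocale closed_lattice: partial_order closed_lattice
  by unfold_locales auto

text \<open>A union of closed sets need not be closed; its hull is the least closed set above
  it.\<close>

lemma least_hull:
  assumes "A \<subseteq> closed_sets"
  shows "least closed_lattice (hull (\<Union>A)) (Upper closed_lattice A)"
proof (rule least_UpperI)
  show "\<And>x. x \<in> A \<Longrightarrow> x \<sqsubseteq>\<^bsub>closed_lattice\<^esub> hull (\<Union>A)"
    using assms closed_subset_top by (fastforce simp: hull_def)
  fix y assume y: "y \<in> Upper closed_lattice A"
  then have "y \<in> closed_sets" and "\<Union>A \<subseteq> y"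
    using assms by (auto simp: Upper_def)
  then show "hull (\<Union>A) \<sqsubseteq>\<^bsub>closed_lattice\<^esub> y"
    using closed_subsetI[of y "hull (\<Union>A)"] by (auto simp: hull_def)
qed (use assms hull_closed in auto)

lemma greatest_Inter:
  assumes "A \<subseteq> closed_sets"
  shows "greatest closed_lattice (U \<inter> \<Inter>A) (Lower closed_lattice A)"
proof (rule greatest_LowerI)
  fix y assume "y \<in> Lower closed_lattice A"
  then have "y \<in> closed_sets" and "\<forall>a\<in>A. y \<subseteq> a"
    using assms by (auto simp: Lower_def)
  then show "y \<sqsubseteq>\<^bsub>closed_lattice\<^esub> U \<inter> \<Inter>A"
    using closed_subset_top by auto
qed (use assms Inter_closed in auto)

sublocale closed_lattice: complete_lattice closed_lattice
proof
  fix A assume "A \<subseteq> carrier closed_lattice"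
  then show "\<exists>s. least closed_lattice s (Upper closed_lattice A)" "\<exists>i. greatest closed_lattice i (Lower closed_lattice A)"
    using least_hull greatest_Inter by auto
qed

lemma sup_eq: "A \<subseteq> closed_sets \<Longrightarrow> \<Squnion>\<^bsub>closed_lattice\<^esub>A = hull (\<Union>A)"
  by (metis closed_lattice_simps(1) closed_lattice.least_unique closed_lattice.sup_lub least_hull)

lemma inf_eq: "A \<subseteq> closed_sets \<Longrightarrow> \<Sqinter>\<^bsub>closed_lattice\<^esub>A = U \<inter> \<Inter>A"
  by (metis closed_lattice_simps(1) closed_lattice.greatest_unique closed_lattice.inf_glb greatest_Inter)

lemma meet_eq: "I \<in> closed_sets \<Longrightarrow> J \<in> closed_sets \<Longrightarrow> I \<sqinter>\<^bsub>closed_lattice\<^esub> J = I \<inter> J"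
  using inf_eq[of "{I, J}"] closed_subset_top[of I] by (auto simp: meet_def)

text \<open>Joins are preserved because \<open>P\<close> contains the hull of a union exactly when
  it contains every member; finite meets are preserved because \<open>P\<close> is proper and
  meet-prime.\<close>

lemma frame_morphism_point:
  assumes "P \<in> Ps"
  shows "frame_morphism closed_lattice two_frame (\<lambda>I. \<not> I \<subseteq> P)"
  unfolding frame_morphism_def
proof (intro conjI allI impI)
  show "(\<lambda>I. \<not> I \<subseteq> P) \<in> carrier closed_lattice \<rightarrow> carrier two_frame"
    by (simp add: two_frame_def)
  fix A assume "A \<subseteq> carrier closed_lattice"
  then have A: "A \<subseteq> closed_sets" by simp
  then have "\<Union>A \<subseteq> U" using closed_subset_top by blast
  then show "(\<not> \<Squnion>\<^bsub>closed_lattice\<^esub>A \<subseteq> P) = \<Squnion>\<^bsub>two_frame\<^esub>((\<lambda>I. \<not> I \<subseteq> P) ` A)"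
    using A assms by (auto simp: sup_eq two_frame_sup hull_subset_iff)
  assume "finite A"
  then show "(\<not> \<Sqinter>\<^bsub>closed_lattice\<^esub>A \<subseteq> P) = \<Sqinter>\<^bsub>two_frame\<^esub>((\<lambda>I. \<not> I \<subseteq> P) ` A)"
    using A assms by (auto simp only: inf_eq two_frame_inf finite_Inter_subset_iff image_iff)
qed

text \<open>Both sides are closed and lie below the same members of \<open>Ps\<close>, namely those
  containing \<open>x\<close> or all of \<open>A\<close>.\<close>

lemma Int_hull:
  assumes x: "x \<in> closed_sets" and A: "A \<subseteq> closed_sets"
  shows "x \<inter> hull (\<Union>A) = hull (\<Union>a\<in>A. x \<inter> a)"
proof
  have AU: "\<Union>A \<subseteq> U" using A closed_subset_top by blast
  show "x \<inter> hull (\<Union>A) \<subseteq> hull (\<Union>a\<in>A. x \<inter> a)"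
  proof (rule closed_subsetI[OF hull_closed])
    fix P assume P: "P \<in> Ps" "hull (\<Union>a\<in>A. x \<inter> a) \<subseteq> P"
    have "(\<Union>a\<in>A. x \<inter> a) \<subseteq> P"
      using P AU by (subst (asm) hull_subset_iff) auto
    \<comment> \<open>If \<open>x\<close> is not inside \<open>P\<close>, then for each
      \<open>a\<close> in \<open>A\<close> meet-primeness applied to \<open>x \<inter> a\<close>
      puts \<open>a\<close> inside \<open>P\<close>.\<close>
    then have "x \<subseteq> P \<or> \<Union>A \<subseteq> P"
      using Int_subset_iff[OF P(1) x] A by blast
    then show "x \<inter> hull (\<Union>A) \<subseteq> P"
      using hull_subset_iff[OF P(1) AU] by blast
  qed (auto simp: hull_def)
  show "hull (\<Union>a\<in>A. x \<inter> a) \<subseteq> x \<inter> hull (\<Union>A)"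
  proof (rule closed_subsetI[OF Int_closed[OF x hull_closed]])
    fix P assume P: "P \<in> Ps" "x \<inter> hull (\<Union>A) \<subseteq> P"
    then have "x \<subseteq> P \<or> \<Union>A \<subseteq> P"
      using Int_subset_iff[OF P(1) x hull_closed] hull_subset_iff[OF P(1) AU] by simp
    then show "hull (\<Union>a\<in>A. x \<inter> a) \<subseteq> P"
      using P AU by (subst hull_subset_iff) auto
  qed (auto simp: hull_def)
qed

lemma spatial_frame_closed_lattice: "spatial_frame closed_lattice"
proof
  fix x A assume "x \<in> carrier closed_lattice" and "A \<subseteq> carrier closed_lattice"
  then have x: "x \<in> closed_sets" and A: "A \<subseteq> closed_sets" by auto
  have "x \<sqinter>\<^bsub>closed_lattice\<^esub> \<Squnion>\<^bsub>closed_lattice\<^esub>A = x \<inter> hull (\<Union>A)"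
    using x A by (simp add: sup_eq meet_eq hull_closed)
  also have "\<dots> = hull (\<Union>a\<in>A. x \<inter> a)"
    using x A by (rule Int_hull)
  also have "\<dots> = \<Squnion>\<^bsub>closed_lattice\<^esub>((\<lambda>a. x \<inter> a) ` A)"
    using x A Int_closed by (intro sup_eq[symmetric]) auto
  also have "(\<lambda>a. x \<inter> a) ` A = (\<lambda>a. x \<sqinter>\<^bsub>closed_lattice\<^esub> a) ` A"
    using x A meet_eq by (intro image_cong refl) blast
  finally show "x \<sqinter>\<^bsub>closed_lattice\<^esub> \<Squnion>\<^bsub>closed_lattice\<^esub>A = \<Squnion>\<^bsub>closed_lattice\<^esub>((\<lambda>a. x \<sqinter>\<^bsub>closed_lattice\<^esub> a) ` A)" .
next
  fix x y assume xy: "x \<in> carrier closed_lattice" "y \<in> carrier closed_lattice" "\<not> x \<sqsubseteq>\<^bsub>closed_lattice\<^esub> y"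
  \<comment> \<open>Were there no such \<open>P\<close>, testing on \<open>Ps\<close> would give
    \<open>x \<subseteq> y\<close>.\<close>
  then obtain P where "P \<in> Ps" "y \<subseteq> P" "\<not> x \<subseteq> P"
    using closed_subsetI[of y x] closed_subset_top[of x] by auto
  then show "\<exists>p. frame_morphism closed_lattice two_frame p \<and> p x = True \<and> p y = False"
    using frame_morphism_point by (intro exI[of _ "\<lambda>I. \<not> I \<subseteq> P"]) simp
qed

end

section \<open>Thick and prime tensor ideals\<close>

context monoidal_triangulated_category
begin

lemma ShO_closed: "X \<in> Obj K \<Longrightarrow> ShO K X \<in> Obj K"
  using shift_additive by (simp add: additive_functor_def is_functor_def)

lemma thick_ideal_Obj: "thick_ideal K (Obj K)"
proof -
  have "Z \<in> Obj K" if "dist_triangle K X Y Z f g h" for X Y Z f g h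
    using that Cod_closed[of g] by (auto simp: dist_triangle_def is_triangle_def Hom_def)
  then show ?thesis
    unfolding thick_ideal_def thick_subcategory_def triangulated_subcategory_def
    using ShO_closed TenO_closed by (intro conjI subset_refl ballI allI impI)
      (simp add: zero_object_def | assumption | blast)+
qed

text \<open>Every closure condition passes from the members to the intersection. The separate
  \<open>I\<close> keeps the family nonempty, so the result stays inside \<open>Obj K\<close> even
  when \<open>S\<close> is empty.\<close>

lemma thick_ideal_Int:
  assumes "thick_ideal K I" "\<And>J. J \<in> S \<Longrightarrow> thick_ideal K J"
  shows "thick_ideal K (I \<inter> \<Inter>S)"
proof -
  let ?F = "insert I S"
  have ideal: "thick_ideal K J" if "J \<in> ?F" for J
    using that assms by blast
  have sub: "triangulated_subcategory K J" if "J \<in> ?F" for J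
    using ideal[OF that] by (simp add: thick_ideal_def thick_subcategory_def)
  have "triangulated_subcategory K (\<Inter>?F)"
    unfolding triangulated_subcategory_def
  proof (intro conjI allI ballI impI InterI)
    show "\<Inter>?F \<subseteq> Obj K"
      using sub[of I] by (auto simp: triangulated_subcategory_def)
    show "Z \<in> J" if "zero_object K Z" "J \<in> ?F" for Z J
      using sub[OF that(2)] that(1) by (simp add: triangulated_subcategory_def)
    show "Y \<in> J" if "X \<in> \<Inter>?F" "Y \<in> Obj K" "isomorphic K X Y" "J \<in> ?F" for X Y J
      using sub[OF that(4)] InterD[OF that(1,4)] that(2,3)
      unfolding triangulated_subcategory_def by blast
    show "ShO K X \<in> \<Inter>?F \<longleftrightarrow> X \<in> \<Inter>?F" if "X \<in> Obj K" for X
    proof -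
      have "ShO K X \<in> J \<longleftrightarrow> X \<in> J" if "J \<in> ?F" for J
        using sub[OF that] \<open>X \<in> Obj K\<close> by (simp add: triangulated_subcategory_def)
      then show ?thesis by simp
    qed
    show "Z \<in> J"
      if "dist_triangle K X Y Z f g h" "X \<in> \<Inter>?F" "Y \<in> \<Inter>?F" "J \<in> ?F" for X Y Z f g h J
      using sub[OF that(4)] InterD[OF that(2,4)] InterD[OF that(3,4)] that(1)
      unfolding triangulated_subcategory_def by blast
  qed
  moreover have "A \<in> J \<and> B \<in> J"
    if "J \<in> ?F" "Y \<in> J" "A \<in> Obj K" "B \<in> Obj K" "is_biproduct K A B Y" for J Y A B
    using ideal[OF that(1)] that(2-) unfolding thick_ideal_def thick_subcategory_def by blast
  then have "A \<in> \<Inter>?F \<and> B \<in> \<Inter>?F"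
    if "Y \<in> \<Inter>?F" "A \<in> Obj K" "B \<in> Obj K" "is_biproduct K A B Y" for Y A B
    using that by (meson InterD InterI)
  moreover have "TenO K X Y \<in> J \<and> TenO K Y X \<in> J"
    if "J \<in> ?F" "X \<in> J" "Y \<in> Obj K" for J X Y
    using ideal[OF that(1)] that(2-) unfolding thick_ideal_def by blast
  then have "TenO K X Y \<in> \<Inter>?F \<and> TenO K Y X \<in> \<Inter>?F"
    if "X \<in> \<Inter>?F" "Y \<in> Obj K" for X Y
    using that by (meson InterD InterI)
  ultimately have "thick_ideal K (\<Inter>?F)"
    unfolding thick_ideal_def thick_subcategory_def by (intro conjI ballI impI) blast+
  then show ?thesis by simp
qed

lemma thick_ideal_subset_Obj: "thick_ideal K I \<Longrightarrow> I \<subseteq> Obj K"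
  by (simp add: thick_ideal_def thick_subcategory_def triangulated_subcategory_def)

lemma thick_ideal_Obj_Int:
  "S \<subseteq> {P. prime_ideal K P} \<Longrightarrow> thick_ideal K (Obj K \<inter> \<Inter>S)"
  using thick_ideal_Int[OF thick_ideal_Obj] by (auto simp: prime_ideal_def)

lemma prime_ideal_meet_prime:
  assumes "prime_ideal K P" "thick_ideal K I" "thick_ideal K J" "I \<inter> J \<subseteq> P"
  shows "I \<subseteq> P \<or> J \<subseteq> P"
proof -
  \<comment> \<open>Ideals are two-sided: \<open>TenO K X Y\<close> is in \<open>I\<close> because
    \<open>X\<close> is, and in \<open>J\<close> because \<open>Y\<close> is.\<close>
  have "{TenO K X Y | X Y. X \<in> I \<and> Y \<in> J} \<subseteq> I \<inter> J"
    using assms(2,3) thick_ideal_subset_Obj unfolding thick_ideal_def by blast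
  with assms show ?thesis
    unfolding prime_ideal_def by (meson subset_trans)
qed

text \<open>Primeness speaks only of thick ideals; it applies here because intersections of primes
  with \<open>Obj K\<close> are thick ideals.\<close>

sublocale primes: meet_prime_family "Obj K" "{P. prime_ideal K P}"
proof
  fix P S T
  assume P: "P \<in> {P. prime_ideal K P}"
  then show "P \<subseteq> Obj K" "P \<noteq> Obj K"
    using thick_ideal_subset_Obj by (auto simp: prime_ideal_def)
  assume "S \<subseteq> {P. prime_ideal K P}" "T \<subseteq> {P. prime_ideal K P}" "Obj K \<inter> \<Inter>S \<inter> \<Inter>T \<subseteq> P"
  with P show "Obj K \<inter> \<Inter>S \<subseteq> P \<or> Obj K \<inter> \<Inter>T \<subseteq> P"
    by (intro prime_ideal_meet_prime thick_ideal_Obj_Int) auto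
qed

lemma semiprime_lattice_eq: "T\<^sub>s K = primes.closed_lattice"
  using thick_ideal_Obj_Int
  by (auto simp: semiprime_lattice_def primes.closed_lattice_def primes.closed_sets_def semiprime_ideal_def)

end

theorem corollary4p8:
  fixes K :: "('o, 'm) mt_data"
  assumes "monoidal_triangulated_category K"
    and "essentially_small TYPE('u) K"
  shows "spatial_frame (T\<^sub>s K)"
proof -
  interpret monoidal_triangulated_category K by fact
  show ?thesis
    unfolding semiprime_lattice_eq by (rule primes.spatial_frame_closed_lattice)
qed

end
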